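(* There exists a bounded bilinear map $D:\ell^2\times\ell^2\to\ell^2$ such that the space $\mathbb{H}_*$ is not closed under the action of the associated extension $D_*$. That is, boundedness of $D$ from $\mathbb{H}\times\mathbb{H}$ to $\mathbb{H}$ does not imply that $\mathbb{H}_*$ is closed under the action of $D_*$.
   Context: Here $\mathbb{H}=\ell^2$ is the real Hilbert space of square-summable sequences. $\mathbb{H}_*$ is the space of functions $f=(f_n)_{n\ge1}$ on $\mathbb{R}_+=[0,\infty)$ with $\big(\sup_{x\ge0}|f_n(x)|\big)_{n\ge1}\in\ell^2$, normed by $\|f\|_{\mathbb{H}_*}=\big(\sum_{n\ge1}(\sup_{x\ge0}|f_n(x)|)^2\big)^{1/2}$. $D_*$ is the pointwise extension of $D$: $D_*(u,v)(x)=D(u(x),v(x))$. $\mathbb{H}_*$ is said to be closed under the action of $D_*$ if $D_*(v,v)\in\mathbb{H}_*$ for every $v\in\mathbb{H}_*$ and there is a constant $C$ with $\|D_*(v,v)\|_{\mathbb{H}_*}\le C\|v\|_{\mathbb{H}_*}^2$ for all $v\in\mathbb{H}_*$. *)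

theory Defs
  imports "HOL-Analysis.Analysis"
begin

typedef ell2 = "{a :: nat \<Rightarrow> real. summable (\<lambda>n. (a n)\<^sup>2)}"
  morphisms ell2_nth Abs_ell2
  by (rule exI[of _ "\<lambda>_. 0"]) simp

setup_lifting type_definition_ell2

lemma summable_ell2_nth_sq: "summable (\<lambda>n. (ell2_nth a n)\<^sup>2)"
  using ell2_nth[of a] by simp

lemma summable_mult_of_summable_sq:
  fixes a b :: "nat \<Rightarrow> real"
  assumes "summable (\<lambda>n. (a n)\<^sup>2)" "summable (\<lambda>n. (b n)\<^sup>2)"
  shows "summable (\<lambda>n. a n * b n)"
proof (rule summable_comparison_test')
  show "summable (\<lambda>n. (a n)\<^sup>2 + (b n)\<^sup>2)"
    using assms by (rule summable_add)
  show "norm (a n * b n) \<le> (a n)\<^sup>2 + (b n)\<^sup>2" if "n \<ge> 0" for n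
  proof -
    have "2 * (\<bar>a n\<bar> * \<bar>b n\<bar>) \<le> (a n)\<^sup>2 + (b n)\<^sup>2"
      using sum_squares_bound[of "\<bar>a n\<bar>" "\<bar>b n\<bar>"] by (simp add: mult.assoc)
    moreover have "0 \<le> \<bar>a n\<bar> * \<bar>b n\<bar>" by simp
    ultimately show ?thesis unfolding real_norm_def abs_mult by linarith
  qed
qed

lemma summable_ell2_nth_mult: "summable (\<lambda>n. ell2_nth a n * ell2_nth b n)"
  by (intro summable_mult_of_summable_sq summable_ell2_nth_sq)

instantiation ell2 :: real_inner
begin

lift_definition zero_ell2 :: ell2 is "\<lambda>_. 0" by simp

lift_definition uminus_ell2 :: "ell2 \<Rightarrow> ell2" is "\<lambda>a n. - a n" by simp

lift_definition plus_ell2 :: "ell2 \<Rightarrow> ell2 \<Rightarrow> ell2" is "\<lambda>a b n. a n + b n"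
proof -
  fix a b :: "nat \<Rightarrow> real"
  assume a: "summable (\<lambda>n. (a n)\<^sup>2)" and b: "summable (\<lambda>n. (b n)\<^sup>2)"
  have "summable (\<lambda>n. (a n)\<^sup>2 + (b n)\<^sup>2 + 2 * (a n * b n))"
    by (intro summable_add summable_mult summable_mult_of_summable_sq a b)
  then show "summable (\<lambda>n. (a n + b n)\<^sup>2)"
    by (simp add: power2_sum mult.assoc)
qed

definition minus_ell2 :: "ell2 \<Rightarrow> ell2 \<Rightarrow> ell2" where
  "minus_ell2 a b = a + - b"

lift_definition scaleR_ell2 :: "real \<Rightarrow> ell2 \<Rightarrow> ell2" is "\<lambda>c a n. c * a n"
  by (simp add: power_mult_distrib summable_mult)

definition inner_ell2 :: "ell2 \<Rightarrow> ell2 \<Rightarrow> real" where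
  "inner_ell2 a b = (\<Sum>n. ell2_nth a n * ell2_nth b n)"

definition norm_ell2 :: "ell2 \<Rightarrow> real" where
  "norm_ell2 a = sqrt (inner a a)"

definition dist_ell2 :: "ell2 \<Rightarrow> ell2 \<Rightarrow> real" where
  "dist_ell2 a b = norm (a - b)"

definition sgn_ell2 :: "ell2 \<Rightarrow> ell2" where
  "sgn_ell2 a = inverse (norm a) *\<^sub>R a"

definition uniformity_ell2 :: "(ell2 \<times> ell2) filter" where
  "uniformity_ell2 = (INF e\<in>{0<..}. principal {(a, b). dist a b < e})"

definition open_ell2 :: "ell2 set \<Rightarrow> bool" where
  "open_ell2 U \<longleftrightarrow> (\<forall>a\<in>U. \<forall>\<^sub>F (a', b) in uniformity. a' = a \<longrightarrow> b \<in> U)"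

instance
proof
  fix a b c :: ell2 and r s :: real and U :: "ell2 set"
  show "a + b + c = a + (b + c)" "a + b = b + a" "0 + a = a" "- a + a = 0"
    "r *\<^sub>R (a + b) = r *\<^sub>R a + r *\<^sub>R b" "(r + s) *\<^sub>R a = r *\<^sub>R a + s *\<^sub>R a"
    "r *\<^sub>R s *\<^sub>R a = (r * s) *\<^sub>R a" "1 *\<^sub>R a = a"
    by (transfer; simp add: algebra_simps)+
  show "a - b = a + - b" by (rule minus_ell2_def)
  show "dist a b = norm (a - b)" by (rule dist_ell2_def)
  show "sgn a = inverse (norm a) *\<^sub>R a" by (rule sgn_ell2_def)
  show "uniformity = (INF e\<in>{0<..}. principal {(a :: ell2, b). dist a b < e})"
    by (rule uniformity_ell2_def)
  show "open U \<longleftrightarrow> (\<forall>a\<in>U. \<forall>\<^sub>F (a', b) in uniformity. a' = a \<longrightarrow> b \<in> U)"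
    by (rule open_ell2_def)
  show "norm a = sqrt (inner a a)" by (rule norm_ell2_def)
  show "inner a b = inner b a" by (simp add: inner_ell2_def mult.commute)
  show "inner (a + b) c = inner a c + inner b c"
    by (simp add: inner_ell2_def plus_ell2.rep_eq distrib_right
        suminf_add[OF summable_ell2_nth_mult summable_ell2_nth_mult])
  show "inner (r *\<^sub>R a) b = r * inner a b"
    by (simp add: inner_ell2_def scaleR_ell2.rep_eq mult.assoc
        suminf_mult[OF summable_ell2_nth_mult])
  show "0 \<le> inner a a"
    unfolding inner_ell2_def by (rule suminf_nonneg[OF summable_ell2_nth_mult]) simp
  have "inner a a = 0 \<longleftrightarrow> (\<forall>n. ell2_nth a n * ell2_nth a n = 0)"
    unfolding inner_ell2_def by (rule suminf_eq_zero_iff[OF summable_ell2_nth_mult]) simp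
  also have "\<dots> \<longleftrightarrow> a = 0"
    by (auto simp: ell2_nth_inject[symmetric] zero_ell2.rep_eq fun_eq_iff)
  finally show "inner a a = 0 \<longleftrightarrow> a = 0" .
qed

end

text \<open>
  Functions on \<open>[0,\<infinity>)\<close> are represented by functions on \<^typ>\<open>real\<close>; every notion below
  depends only on their values at \<open>x \<ge> 0\<close>. Taking them \<^typ>\<open>ell2\<close>-valued loses nothing,
  since square-summability of the suprema implies \<open>f x \<in> \<ell>\<^sup>2\<close> for every \<open>x \<ge> 0\<close>.
\<close>

definition sup_abs :: "(real \<Rightarrow> ell2) \<Rightarrow> nat \<Rightarrow> real" where
  "sup_abs f n = (SUP x\<in>{0..}. \<bar>ell2_nth (f x) n\<bar>)"

text \<open>
  The boundedness clause says that each supremum is finite, which the total function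
  \<^const>\<open>Sup\<close> on the reals does not record.
\<close>

definition H_star :: "(real \<Rightarrow> ell2) set" where
  "H_star = {f. (\<forall>n. bdd_above ((\<lambda>x. \<bar>ell2_nth (f x) n\<bar>) ` {0..})) \<and>
                summable (\<lambda>n. (sup_abs f n)\<^sup>2)}"

definition norm_star :: "(real \<Rightarrow> ell2) \<Rightarrow> real" where
  "norm_star f = sqrt (\<Sum>n. (sup_abs f n)\<^sup>2)"

definition D_star ::
    "(ell2 \<Rightarrow> ell2 \<Rightarrow> ell2) \<Rightarrow> (real \<Rightarrow> ell2) \<Rightarrow> (real \<Rightarrow> ell2) \<Rightarrow> (real \<Rightarrow> ell2)" where
  "D_star D u v = (\<lambda>x. D (u x) (v x))"

definition H_star_closed_under :: "(ell2 \<Rightarrow> ell2 \<Rightarrow> ell2) \<Rightarrow> bool" where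
  "H_star_closed_under D \<longleftrightarrow>
     (\<forall>v\<in>H_star. D_star D v v \<in> H_star) \<and>
     (\<exists>C. \<forall>v\<in>H_star. norm_star (D_star D v v) \<le> C * (norm_star v)\<^sup>2)"

end

theory Submission
  imports Defs "HOL-Library.Discrete_Functions"
begin

text \<open>
  Membership in \<^const>\<open>H_star\<close> only controls the coordinatewise suprema of a function, so the
  signs of its coordinates may vary freely with \<open>x\<close>. A bounded matrix whose matrix of absolute
  values is unbounded on \<open>\<ell>\<^sup>2\<close> therefore breaks the space: at the point \<open>x = n\<close> the signs can be
  chosen to remove all cancellation from row \<open>n\<close>, and the supremum over \<open>x\<close> then sees the matrix
  of absolute values.

  Walsh-Hadamard matrices have this property. The normalised one of size \<open>2^k\<close> is orthogonal, but
  its entries are \<open>\<plusminus> 2 powr (-k/2)\<close>, so its matrix of absolute values has norm \<open>2 powr (k/2)\<close>.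
  Placing one of each size on the dyadic blocks \<open>{2^k..<2^(k+1)}\<close> gives an isometry \<open>T\<close>
  of \<open>\<ell>\<^sup>2\<close>, and \<open>D u v = u\<^sub>0 T v\<close> is bounded and bilinear
  (\<open>bounded_bilinear_block_walsh\<close>). The functions testing it are
  \<open>v x = e\<^sub>0 + 2 powr (-k/2) \<Sum>\<^sub>j \<epsilon>\<^sub>j e\<^sub>j\<close>, where \<open>j\<close> ranges over the \<open>k\<close>-th block and \<open>\<epsilon>\<close> is the sign
  pattern of row \<open>\<lfloor>x\<rfloor>\<close>. Their squared norm is \<open>2\<close>, while \<open>D_star D v v\<close> has supremum at least \<open>1\<close>
  in each of the \<open>2^k\<close> coordinates of the block (\<open>walsh_sign_row\<close>), hence norm at least
  \<open>2 powr (k/2)\<close>. No constant \<open>C\<close> works for every \<open>k\<close>.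
\<close>

section \<open>The Walsh-Hadamard transform on dyadic intervals\<close>

text \<open>
  This is the fast Walsh-Hadamard recursion, written on whole sequences: \<open>walsh k\<close> acts on every
  interval \<open>{2^k * q..<2^k * (q+1)}\<close> separately as the normalised Hadamard matrix of size \<open>2^k\<close>.
  The matrix entries never have to be mentioned.
\<close>

primrec walsh :: "nat \<Rightarrow> (nat \<Rightarrow> real) \<Rightarrow> nat \<Rightarrow> real" where
  "walsh 0 a n = a n"
| "walsh (Suc k) a n =
     walsh k (\<lambda>j. (a (2 * j) + (if odd n then - a (2 * j + 1) else a (2 * j + 1))) / sqrt 2) (n div 2)"

lemma walsh_add: "walsh k (\<lambda>j. a j + b j) n = walsh k a n + walsh k b n"
proof (induction k arbitrary: a b n)
  case (Suc k)
  show ?case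
    by (cases "odd n")
      (simp_all add: Suc.IH[symmetric] add_divide_distrib diff_divide_distrib algebra_simps)
qed simp

lemma walsh_scale: "walsh k (\<lambda>j. c * a j) n = c * walsh k a n"
proof (induction k arbitrary: a n)
  case (Suc k)
  show ?case
    by (cases "odd n")
      (simp_all add: Suc.IH[symmetric] add_divide_distrib diff_divide_distrib algebra_simps)
qed simp

lemma walsh_cong:
  assumes "\<And>m. m div 2 ^ k = n div 2 ^ k \<Longrightarrow> a m = b m"
  shows "walsh k a n = walsh k b n"
  using assms
proof (induction k arbitrary: a b n)
  case (Suc k)
  have "a (2 * j) = b (2 * j) \<and> a (2 * j + 1) = b (2 * j + 1)"
    if "j div 2 ^ k = n div 2 div 2 ^ k" for j
    using that by (intro conjI Suc.prems) (simp_all add: div_mult2_eq)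
  then show ?case
    by (auto intro!: Suc.IH)
qed simp

lemma sum_lessThan_double:
  fixes f :: "nat \<Rightarrow> 'a::comm_monoid_add"
  shows "(\<Sum>n<2 * N. f n) = (\<Sum>n<N. f (2 * n) + f (2 * n + 1))"
  by (induction N) (simp_all add: ac_simps)

text \<open>
  Each step of the recursion applies a reflection of the plane to every pair of entries
  \<open>2 * j, 2 * j + 1\<close>, which preserves the sum of their squares.
\<close>

lemma sum_walsh_square:
  "(\<Sum>n<2 ^ k * M. (walsh k a n)\<^sup>2) = (\<Sum>n<2 ^ k * M. (a n)\<^sup>2)"
proof (induction k arbitrary: a)
  case (Suc k)
  let ?p = "\<lambda>j. (a (2 * j) + a (2 * j + 1)) / sqrt 2"
  let ?m = "\<lambda>j. (a (2 * j) - a (2 * j + 1)) / sqrt 2"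
  have "(\<Sum>n<2 ^ Suc k * M. (walsh (Suc k) a n)\<^sup>2)
      = (\<Sum>n<2 ^ k * M. (walsh k ?p n)\<^sup>2 + (walsh k ?m n)\<^sup>2)"
    using sum_lessThan_double[of "\<lambda>n. (walsh (Suc k) a n)\<^sup>2" "2 ^ k * M"]
    by (simp add: mult.assoc)
  also have "\<dots> = (\<Sum>n<2 ^ k * M. (?p n)\<^sup>2 + (?m n)\<^sup>2)"
    by (simp add: sum.distrib Suc.IH)
  also have "\<dots> = (\<Sum>n<2 ^ k * M. (a (2 * n))\<^sup>2 + (a (2 * n + 1))\<^sup>2)"
    by (intro sum.cong) (simp_all add: power2_eq_square field_simps)
  also have "\<dots> = (\<Sum>n<2 ^ Suc k * M. (a n)\<^sup>2)"
    using sum_lessThan_double[of "\<lambda>n. (a n)\<^sup>2" "2 ^ k * M"]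
    by (simp add: mult.assoc)
  finally show ?case .
qed simp

text \<open>
  The pattern \<open>s\<close> is the sign pattern of row \<open>n\<close>: against it all \<open>2^k\<close> entries of size
  \<open>1 / sqrt (2^k)\<close> add up. It is lifted through the recursion by giving each pair
  of entries the relative sign with which the row combines them.
\<close>

lemma walsh_sign_row:
  "\<exists>s. (\<forall>j. \<bar>s j\<bar> = 1) \<and> walsh k s n = sqrt (2 ^ k)"
proof (induction k arbitrary: n)
  case 0
  show ?case by (rule exI[of _ "\<lambda>_. 1"]) simp
next
  case (Suc k)
  obtain s where s: "\<And>j. \<bar>s j\<bar> = 1" "walsh k s (n div 2) = sqrt (2 ^ k)"
    using Suc.IH by blast
  define s' where "s' m = (if odd m \<and> odd n then - s (m div 2) else s (m div 2))" for m
  have "(s' (2 * j) + (if odd n then - s' (2 * j + 1) else s' (2 * j + 1))) / sqrt 2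
      = sqrt 2 * s j" for j
    by (simp add: s'_def field_simps)
  then have "walsh (Suc k) s' n = walsh k (\<lambda>j. sqrt 2 * s j) (n div 2)"
    by (simp only: walsh.simps)
  also have "\<dots> = sqrt (2 ^ Suc k)"
    by (simp add: walsh_scale s real_sqrt_mult)
  finally have "walsh (Suc k) s' n = sqrt (2 ^ Suc k)" .
  moreover have "\<bar>s' j\<bar> = 1" for j
    by (simp add: s'_def s(1))
  ultimately show ?case
    by blast
qed

section \<open>An isometry assembled from all Hadamard matrices\<close>

text \<open>
  As \<open>floor_log 0 = 0\<close>, index \<open>0\<close> is a block of its own and is left fixed.
\<close>

definition block_walsh :: "(nat \<Rightarrow> real) \<Rightarrow> nat \<Rightarrow> real" where
  "block_walsh a n = walsh (floor_log n) a n"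

lemma floor_log_dyadic_block: "n \<in> {2 ^ k..<2 ^ Suc k} \<Longrightarrow> floor_log n = k"
  by (intro floor_log_eqI) auto

lemma sum_block_walsh_square:
  "(\<Sum>n<2 ^ K. (block_walsh a n)\<^sup>2) = (\<Sum>n<2 ^ K. (a n)\<^sup>2)"
proof (induction K)
  case 0
  show ?case by (simp add: block_walsh_def)
next
  case (Suc K)
  have split: "(\<Sum>n<2 ^ Suc K. f n) = (\<Sum>n<2 ^ K. f n) + (\<Sum>n=2 ^ K..<2 ^ Suc K. f n)"
    for f :: "nat \<Rightarrow> real"
    unfolding lessThan_atLeast0 by (intro sum.atLeastLessThan_concat[symmetric]) auto
  have "(\<Sum>n=2 ^ K..<2 ^ Suc K. (block_walsh a n)\<^sup>2)
      = (\<Sum>n=2 ^ K..<2 ^ Suc K. (walsh K a n)\<^sup>2)"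
    by (intro sum.cong) (auto simp: block_walsh_def floor_log_dyadic_block)
  also have "\<dots> = (\<Sum>n=2 ^ K..<2 ^ Suc K. (a n)\<^sup>2)"
    using sum_walsh_square[where k = K and M = 2 and a = a]
      sum_walsh_square[where k = K and M = 1 and a = a]
      split[of "\<lambda>n. (walsh K a n)\<^sup>2"] split[of "\<lambda>n. (a n)\<^sup>2"]
    by (simp add: mult.commute)
  finally show ?case
    using Suc.IH split by simp
qed

lemma sum_block_walsh_square_le:
  assumes "summable (\<lambda>n. (a n)\<^sup>2)"
  shows "(\<Sum>n<N. (block_walsh a n)\<^sup>2) \<le> (\<Sum>n. (a n)\<^sup>2)"
proof -
  have "(\<Sum>n<N. (block_walsh a n)\<^sup>2) \<le> (\<Sum>n<2 ^ N. (block_walsh a n)\<^sup>2)"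
    using less_exp[of N] by (intro sum_mono2) auto
  also have "\<dots> \<le> (\<Sum>n. (a n)\<^sup>2)"
    unfolding sum_block_walsh_square by (intro sum_le_suminf assms) auto
  finally show ?thesis .
qed

lemma summable_block_walsh_square:
  assumes "summable (\<lambda>n. (a n)\<^sup>2)"
  shows "summable (\<lambda>n. (block_walsh a n)\<^sup>2)"
  by (intro summableI_nonneg_bounded[OF _ sum_block_walsh_square_le[OF assms]]) auto

lift_definition ell2_walsh :: "ell2 \<Rightarrow> ell2" is block_walsh
  by (rule summable_block_walsh_square)

lemma norm_ell2_square: "(norm a)\<^sup>2 = (\<Sum>n. (ell2_nth a n)\<^sup>2)" for a :: ell2
proof -
  have "(norm a)\<^sup>2 = inner a a"
    by (rule power2_norm_eq_inner)
  then show ?thesis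
    unfolding inner_ell2_def by (simp only: power2_eq_square)
qed

lemma bounded_linear_ell2_walsh: "bounded_linear ell2_walsh"
proof (rule bounded_linear_intro[where K = 1])
  fix a b :: ell2 and c :: real
  show "ell2_walsh (a + b) = ell2_walsh a + ell2_walsh b"
    by transfer (simp add: block_walsh_def walsh_add fun_eq_iff)
  show "ell2_walsh (c *\<^sub>R a) = c *\<^sub>R ell2_walsh a"
    by transfer (simp add: block_walsh_def walsh_scale fun_eq_iff)
  have "(norm (ell2_walsh a))\<^sup>2 \<le> (norm a)\<^sup>2"
    unfolding norm_ell2_square ell2_walsh.rep_eq
    by (intro suminf_le_const summable_block_walsh_square sum_block_walsh_square_le
        summable_ell2_nth_sq)
  then show "norm (ell2_walsh a) \<le> norm a * 1"
    by (simp add: power2_le_iff_abs_le)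
qed

lemma abs_ell2_nth_le_norm: "\<bar>ell2_nth a n\<bar> \<le> norm a"
proof -
  have "(\<Sum>m\<in>{n}. (ell2_nth a m)\<^sup>2) \<le> (\<Sum>m. (ell2_nth a m)\<^sup>2)"
    by (intro sum_le_suminf summable_ell2_nth_sq) auto
  then have "(ell2_nth a n)\<^sup>2 \<le> (norm a)\<^sup>2"
    by (simp add: norm_ell2_square)
  then show ?thesis
    by (simp add: power2_le_iff_abs_le)
qed

lemma bounded_linear_ell2_nth: "bounded_linear (\<lambda>a. ell2_nth a n)"
  by (rule bounded_linear_intro[where K = 1])
    (simp_all add: plus_ell2.rep_eq scaleR_ell2.rep_eq abs_ell2_nth_le_norm)

lemma bounded_bilinear_block_walsh:
  "bounded_bilinear (\<lambda>u v. ell2_nth u 0 *\<^sub>R ell2_walsh v)"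
  by (rule bounded_bilinear.comp[OF bounded_bilinear_scaleR bounded_linear_ell2_nth
        bounded_linear_ell2_walsh])

section \<open>Test functions with row-dependent signs\<close>

definition row_sign :: "nat \<Rightarrow> nat \<Rightarrow> nat \<Rightarrow> real" where
  "row_sign k n = (SOME s. (\<forall>j. \<bar>s j\<bar> = 1) \<and> walsh k s n = sqrt (2 ^ k))"

lemma abs_row_sign: "\<bar>row_sign k n j\<bar> = 1"
  and walsh_row_sign: "walsh k (row_sign k n) n = sqrt (2 ^ k)"
  using someI_ex[OF walsh_sign_row[of k n]] unfolding row_sign_def by blast+

text \<open>
  The entry at \<open>0\<close>, which lies outside every block, supplies the factor \<open>u\<^sub>0\<close> of the bilinear map.
\<close>

definition test_fun :: "nat \<Rightarrow> real \<Rightarrow> ell2" where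
  "test_fun k x = Abs_ell2 (\<lambda>j. if j = 0 then 1
     else if j \<in> {2 ^ k..<2 ^ Suc k} then row_sign k (nat \<lfloor>x\<rfloor>) j / sqrt (2 ^ k) else 0)"

lemma ell2_nth_test_fun:
  "ell2_nth (test_fun k x) j = (if j = 0 then 1
     else if j \<in> {2 ^ k..<2 ^ Suc k} then row_sign k (nat \<lfloor>x\<rfloor>) j / sqrt (2 ^ k) else 0)"
proof -
  have "summable (\<lambda>j. (if j = 0 then 1
     else if j \<in> {2 ^ k..<2 ^ Suc k} then row_sign k (nat \<lfloor>x\<rfloor>) j / sqrt (2 ^ k) else 0 :: real)\<^sup>2)"
    by (rule summable_finite[of "insert 0 {2 ^ k..<2 ^ Suc k}"]) auto
  then show ?thesis
    by (simp add: test_fun_def Abs_ell2_inverse)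
qed

lemma abs_test_fun:
  "\<bar>ell2_nth (test_fun k x) j\<bar>
     = (if j = 0 then 1 else if j \<in> {2 ^ k..<2 ^ Suc k} then 1 / sqrt (2 ^ k) else 0)"
  by (simp add: ell2_nth_test_fun abs_row_sign)

lemma sup_abs_test_fun_square_sums: "(\<lambda>j. (sup_abs (test_fun k) j)\<^sup>2) sums 2"
proof -
  let ?B = "{2 ^ k..<2 ^ Suc k} :: nat set"
  have sup: "(sup_abs (test_fun k) j)\<^sup>2
      = (if j = 0 then 1 else if j \<in> ?B then 1 / 2 ^ k else 0)" for j
    by (simp add: sup_abs_def abs_test_fun power_divide)
  have "(\<lambda>j. (sup_abs (test_fun k) j)\<^sup>2) sums
      (\<Sum>j\<in>insert 0 ?B. (sup_abs (test_fun k) j)\<^sup>2)"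
    by (intro sums_finite) (auto simp: sup)
  also have "(\<Sum>j\<in>insert 0 ?B. (sup_abs (test_fun k) j)\<^sup>2) = 1 + (\<Sum>j\<in>?B. 1 / 2 ^ k)"
    by (subst sum.insert) (auto simp: sup intro!: sum.cong)
  also have "\<dots> = 2"
    by simp
  finally show ?thesis .
qed

lemma test_fun_in_H_star: "test_fun k \<in> H_star"
  using sup_abs_test_fun_square_sums[of k]
  by (auto simp: H_star_def abs_test_fun sums_iff intro!: bdd_aboveI[where M = 1])

lemma norm_star_test_fun_square: "(norm_star (test_fun k))\<^sup>2 = 2"
  using sup_abs_test_fun_square_sums[of k] by (simp add: norm_star_def sums_iff)

lemma ell2_walsh_test_fun:
  assumes n: "n \<in> {2 ^ k..<2 ^ Suc k}"
  shows "ell2_nth (ell2_walsh (test_fun k (real n))) n = 1"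
proof -
  have same: "m \<in> {2 ^ k..<2 ^ Suc k}" if "m div 2 ^ k = n div 2 ^ k" for m
  proof -
    have "n div 2 ^ k = 1"
      using n by (intro div_nat_eqI) auto
    with that have "m div 2 ^ k = 1"
      by simp
    then have "1 \<le> m div 2 ^ k" "m div 2 ^ k < 2"
      by simp_all
    then show ?thesis
      by (simp add: less_eq_div_iff_mult_less_eq div_less_iff_less_mult)
  qed
  have "ell2_nth (ell2_walsh (test_fun k (real n))) n
      = walsh k (ell2_nth (test_fun k (real n))) n"
    using n by (simp add: ell2_walsh.rep_eq block_walsh_def floor_log_dyadic_block)
  also have "\<dots> = walsh k (\<lambda>j. (1 / sqrt (2 ^ k)) * row_sign k n j) n"
  proof (rule walsh_cong)
    fix m assume "m div 2 ^ k = n div 2 ^ k"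
    from same[OF this] show "ell2_nth (test_fun k (real n)) m = 1 / sqrt (2 ^ k) * row_sign k n m"
      by (auto simp: ell2_nth_test_fun)
  qed
  also have "\<dots> = 1"
    unfolding walsh_scale walsh_row_sign by simp
  finally show ?thesis .
qed

theorem mainTheorem7:
  "\<exists>D :: ell2 \<Rightarrow> ell2 \<Rightarrow> ell2. bounded_bilinear D \<and> \<not> H_star_closed_under D"
proof (intro exI conjI)
  let ?D = "\<lambda>u v. ell2_nth u 0 *\<^sub>R ell2_walsh v"
  show "bounded_bilinear ?D"
    by (rule bounded_bilinear_block_walsh)
  show "\<not> H_star_closed_under ?D"
  proof
    assume closed: "H_star_closed_under ?D"
    then obtain C where C: "\<And>v. v \<in> H_star \<Longrightarrow> norm_star (D_star ?D v v) \<le> C * (norm_star v)\<^sup>2"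
      unfolding H_star_closed_under_def by blast
    have large: "sqrt (2 ^ k) \<le> C * 2" for k
    proof -
      let ?B = "{2 ^ k..<2 ^ Suc k} :: nat set"
      let ?w = "D_star ?D (test_fun k) (test_fun k)"
      have "?w \<in> H_star"
        using closed test_fun_in_H_star unfolding H_star_closed_under_def by blast
      then have bdd: "\<And>n. bdd_above ((\<lambda>x. \<bar>ell2_nth (?w x) n\<bar>) ` {0..})"
        and summ: "summable (\<lambda>n. (sup_abs ?w n)\<^sup>2)"
        by (auto simp: H_star_def)
      have one: "1 \<le> sup_abs ?w n" if "n \<in> ?B" for n
      proof -
        have "\<bar>ell2_nth (?w (real n)) n\<bar> \<le> sup_abs ?w n"
          unfolding sup_abs_def by (rule cSUP_upper[OF _ bdd]) simp
        then show ?thesis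
          using ell2_walsh_test_fun[OF that]
          by (simp add: D_star_def scaleR_ell2.rep_eq ell2_nth_test_fun)
      qed
      have "2 ^ k = (\<Sum>n\<in>?B. 1 :: real)"
        by simp
      also have "\<dots> \<le> (\<Sum>n\<in>?B. (sup_abs ?w n)\<^sup>2)"
        using one by (intro sum_mono) simp
      also have "\<dots> \<le> (\<Sum>n. (sup_abs ?w n)\<^sup>2)"
        by (intro sum_le_suminf summ) auto
      finally have "sqrt (2 ^ k) \<le> norm_star ?w"
        by (simp add: norm_star_def)
      also have "\<dots> \<le> C * 2"
        using C[OF test_fun_in_H_star] by (simp add: norm_star_test_fun_square)
      finally show ?thesis .
    qed
    obtain k where "(C * 2)\<^sup>2 < 2 ^ k"
      using real_arch_pow[of 2] by auto
    then have "C * 2 < sqrt (2 ^ k)"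
      by (rule real_less_rsqrt)
    with large[of k] show False
      by simp
  qed
qed

end
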